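(* Let $n$ be a positive integer. For every nonempty pitch class set $P \subseteq \mathbb{Z}_n$, the pitch class graph $G(P)$ is uniquely and completely determined by its cycle subgraph $C(P)$. That is: if $P, Q \subseteq \mathbb{Z}_n$ are nonempty sets of the same cardinality and $\varphi : P \to Q$ is an isomorphism of weighted cycles $C(P) \to C(Q)$, then $\varphi$ is an isomorphism of weighted graphs $G(P) \to G(Q)$.
   Context: Elements of $\mathbb{Z}_n$ are represented by integers in $\{0,\ldots,n-1\}$. A pitch class set is a subset $P \subseteq \mathbb{Z}_n$. The interval class is $\mathrm{ic}(p,q) = \min(|p-q|,\ n-|p-q|)$, computed with these representatives. The pitch class graph $G(P)$ is the complete weighted graph with vertex set $P$ in which each unordered pair $\{p,q\}$ of distinct elements of $P$ has weight $w(\{p,q\}) = \mathrm{ic}(p,q)$. An isomorphism of weighted graphs $G(P) \to G(Q)$ is a bijection $\varphi: P \to Q$ with $\mathrm{ic}(\varphi(p),\varphi(q)) = \mathrm{ic}(p,q)$ for all distinct $p,q \in P$. Write a set $P$ of cardinality $k \ge 1$ in ascending order $0 \le p_0 < p_1 < \cdots < p_{k-1} < n$. Its step sequence is $(w_0, \ldots, w_{k-1})$ with $w_i = p_{i+1} - p_i$ for $0 \le i \le k-2$ and $w_{k-1} = n - p_{k-1} + p_0$, so that $w_0 + \cdots + w_{k-1} = n$. The cycle subgraph $C(P)$ is the cycle on the vertices $p_0, p_1, \ldots, p_{k-1}$ (indices modulo $k$) in which the edge joining the consecutive vertices $p_i$ and $p_{i+1}$ carries the step $w_i$. If $Q = \{q_0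 < \cdots < q_{k-1}\}$ has step sequence $(v_0,\ldots,v_{k-1})$, an isomorphism of weighted cycles $C(P) \to C(Q)$ is a bijection $\varphi: P \to Q$ for which there exists $r \in \mathbb{Z}_k$ such that either $\varphi(p_i) = q_{r+i}$ and $w_i = v_{r+i}$ for all $i \in \mathbb{Z}_k$, or $\varphi(p_i) = q_{r-i}$ and $w_i = v_{r-i-1}$ for all $i \in \mathbb{Z}_k$ (indices modulo $k$). *)

theory Defs
  imports Main
begin

definition pitch_class_set :: "int \<Rightarrow> int set \<Rightarrow> bool" where
  "pitch_class_set n P \<longleftrightarrow> P \<subseteq> {0..<n}"

definition ic :: "int \<Rightarrow> int \<Rightarrow> int \<Rightarrow> int" where
  "ic n p q = min \<bar>p - q\<bar> (n - \<bar>p - q\<bar>)"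

(* The weight of the edge {p, q} is the value of edge_weight at p and q. It is meant to be
   symmetric, and only its values at pairs of distinct vertices are meaningful. *)
record 'a complete_wgraph =
  graph_verts :: "'a set"
  edge_weight :: "'a \<Rightarrow> 'a \<Rightarrow> int"

definition wgraph_iso :: "'a complete_wgraph \<Rightarrow> 'b complete_wgraph \<Rightarrow> ('a \<Rightarrow> 'b) \<Rightarrow> bool" where
  "wgraph_iso G H \<phi> \<longleftrightarrow>
     bij_betw \<phi> (graph_verts G) (graph_verts H) \<and>
     (\<forall>p \<in> graph_verts G. \<forall>q \<in> graph_verts G.
        p \<noteq> q \<longrightarrow> edge_weight H (\<phi> p) (\<phi> q) = edge_weight G p q)"

definition pitch_class_graph :: "int \<Rightarrow> int set \<Rightarrow> int complete_wgraph" where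
  "pitch_class_graph n P = \<lparr> graph_verts = P, edge_weight = ic n \<rparr>"

definition step_sequence :: "int \<Rightarrow> int set \<Rightarrow> int list" where
  "step_sequence n P =
     (let p = sorted_list_of_set P; k = length p in
      map (\<lambda>i. if i + 1 < k then p ! (i + 1) - p ! i else n - p ! (k - 1) + p ! 0) [0..<k])"

(* The i-th entry of cycle_weights is the weight of the edge joining the vertices i and i + 1
   (indices modulo the length), so a cycle may be a loop or have two parallel edges. *)
record 'a wcycle =
  cycle_verts :: "'a list"
  cycle_weights :: "int list"

definition cycle_subgraph :: "int \<Rightarrow> int set \<Rightarrow> int wcycle" where
  "cycle_subgraph n P =
     \<lparr> cycle_verts = sorted_list_of_set P, cycle_weights = step_sequence n P \<rparr>"

(* list access with the index taken modulo the length *)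
definition cyc_nth :: "'a list \<Rightarrow> int \<Rightarrow> 'a" where
  "cyc_nth xs j = xs ! nat (j mod int (length xs))"

(* The two disjuncts are the orientation-preserving and the orientation-reversing case; in the
   latter, the edge from vertex i to i + 1 goes to the edge from r - i - 1 to r - i. *)
definition wcycle_iso :: "'a wcycle \<Rightarrow> 'b wcycle \<Rightarrow> ('a \<Rightarrow> 'b) \<Rightarrow> bool" where
  "wcycle_iso C D \<phi> \<longleftrightarrow>
     (let p = cycle_verts C; w = cycle_weights C;
          q = cycle_verts D; v = cycle_weights D;
          k = int (length p) in
      bij_betw \<phi> (set p) (set q) \<and>
      (\<exists>r \<in> {0..<k}.
         (\<forall>i \<in> {0..<k}. \<phi> (cyc_nth p i) = cyc_nth q (r + i) \<and>
                        cyc_nth w i = cyc_nth v (r + i)) \<or>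
         (\<forall>i \<in> {0..<k}. \<phi> (cyc_nth p i) = cyc_nth q (r - i) \<and>
                        cyc_nth w i = cyc_nth v (r - i - 1))))"

end

theory Submission
  imports Defs "HOL-Number_Theory.Cong"
begin

text \<open>
  The interval class of two pitch classes depends only on their difference modulo \<open>n\<close>, up to sign.
  The steps of a set are precisely the differences modulo \<open>n\<close> of cyclically consecutive elements;
  the closing step, which runs from the largest element past \<open>n\<close> back to the smallest, exceeds the
  ordinary difference by exactly \<open>n\<close>. An isomorphism \<open>\<phi>\<close> of the cycles preserves all steps.
  If it keeps the orientation, then \<open>\<phi> p - p\<close> does not change modulo \<open>n\<close> along the cycle, so \<open>\<phi>\<close> is
  the restriction of a transposition \<open>p \<mapsto> p + c\<close>; if it reverses the orientation, then \<open>\<phi> p + p\<close>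
  does not change, and \<open>\<phi>\<close> is the restriction of an inversion \<open>p \<mapsto> c - p\<close>. Both kinds of map
  preserve differences modulo \<open>n\<close> up to sign, hence all interval classes.
\<close>

text \<open>
  In this form the interval class is visibly a function of the residue class of \<open>p - q\<close>; the two
  remainders are the two ways around the circle.
\<close>
lemma ic_eq_min_mod:
  fixes n p q :: int
  assumes "p \<in> {0..<n}" "q \<in> {0..<n}"
  shows "ic n p q = min ((p - q) mod n) ((q - p) mod n)"
proof -
  have wrap: "(x - y) mod n = x - y + n" if "x < y" "0 \<le> x" "y < n" for x y :: int
    using that mod_pos_pos_trivial[of "x - y + n" n] by simp
  consider "p = q" | "p < q" | "q < p" by linarith
  then show ?thesis
    using assms wrap[of p q] wrap[of q p]
    by cases (auto simp: ic_def)
qed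

lemma ic_commute: "ic n p q = ic n q p"
  by (simp add: ic_def abs_minus_commute)

lemma ic_cong:
  assumes "p \<in> {0..<n}" "q \<in> {0..<n}" "p' \<in> {0..<n}" "q' \<in> {0..<n}"
    and "[p' - q' = p - q] (mod n)"
  shows "ic n p' q' = ic n p q"
proof -
  have "[q' - p' = q - p] (mod n)"
    using assms(5) cong_minus_minus_iff[of "p' - q'" "p - q" n] by simp
  with assms show ?thesis by (simp add: ic_eq_min_mod cong_def)
qed

text \<open>
  Taken modulo \<open>n\<close>, the two clauses in the definition of the step sequence become the same recurrence,
  valid at every integer index. This is what makes the position of the starting point \<open>p\<^sub>0\<close> irrelevant.
\<close>
lemma cyc_nth_step_sequence_cong:
  assumes "finite P" "P \<noteq> {}"
  defines "p \<equiv> sorted_list_of_set P"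
  shows "[cyc_nth p (i + 1) = cyc_nth p i + cyc_nth (step_sequence n P) i] (mod n)"
proof -
  define k where "k = length p"
  define j where "j = nat (i mod int k)"
  have "k > 0" using assms by (simp add: k_def card_gt_0_iff)
  then have j: "j < k" "int j = i mod int k"
    by (simp_all add: j_def nat_less_iff)
  have len: "length (step_sequence n P) = k"
    by (simp add: step_sequence_def k_def p_def Let_def)
  have pi: "cyc_nth p i = p ! j" by (simp add: cyc_nth_def j_def k_def)
  have wi: "cyc_nth (step_sequence n P) i =
      (if j + 1 < k then p ! (j + 1) - p ! j else n - p ! (k - 1) + p ! 0)"
    using j(1) unfolding cyc_nth_def len j_def[symmetric]
    by (simp add: step_sequence_def Let_def k_def p_def)
  have succ: "(i + 1) mod int k = int (j + 1) mod int k"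
    using j(2) mod_add_left_eq[of i "int k" 1] by (simp add: add.commute)
  show ?thesis
  proof (cases "j + 1 < k")
    case True
    then have "(i + 1) mod int k = int (j + 1)" using succ by simp
    then have "cyc_nth p (i + 1) = p ! (j + 1)"
      unfolding cyc_nth_def k_def[symmetric] by (simp only: nat_int)
    with True pi wi show ?thesis by simp
  next
    case False
    with j(1) have jk: "k = j + 1" by simp
    then have "(i + 1) mod int k = 0" using succ by simp
    then have "cyc_nth p (i + 1) = p ! 0"
      unfolding cyc_nth_def k_def[symmetric] by simp
    with False pi wi jk show ?thesis by (simp add: cong_def)
  qed
qed

lemma cong_const_on_interval:
  fixes f :: "int \<Rightarrow> int"
  assumes step: "\<And>i. 0 \<le> i \<Longrightarrow> i + 1 < k \<Longrightarrow> [f (i + 1) = f i] (mod n)"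
    and "0 \<le> i" "i < k"
  shows "[f i = f 0] (mod n)"
  using assms(2,3)
proof (induction i rule: int_ge_induct)
  case base
  show ?case by simp
next
  case (step i)
  then show ?case using assms(1)[of i] cong_trans by simp
qed

text \<open>
  The orientation of the isomorphism enters only as the sign \<open>s\<close>, which turns the two cases into one:
  \<open>\<phi> p - s * p\<close> is constant modulo \<open>n\<close>.
\<close>
lemma cycle_iso_transposition_or_inversion:
  assumes fin: "finite P" "P \<noteq> {}" "finite Q" "Q \<noteq> {}"
    and iso: "wcycle_iso (cycle_subgraph n P) (cycle_subgraph n Q) \<phi>"
  obtains s c where "s = 1 \<or> s = -1" "\<And>x. x \<in> P \<Longrightarrow> [\<phi> x - s * x = c] (mod n)"
proof -
  note result = that
  define p where "p = sorted_list_of_set P"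
  define q where "q = sorted_list_of_set Q"
  define w where "w = step_sequence n P"
  define v where "v = step_sequence n Q"
  define k where "k = int (length p)"
  have p_step: "[cyc_nth p (i + 1) = cyc_nth p i + cyc_nth w i] (mod n)" for i
    unfolding p_def w_def by (rule cyc_nth_step_sequence_cong[OF fin(1,2)])
  have q_step: "[cyc_nth q (i + 1) = cyc_nth q i + cyc_nth v i] (mod n)" for i
    unfolding q_def v_def by (rule cyc_nth_step_sequence_cong[OF fin(3,4)])
  have const: thesis
    if s: "s = 1 \<or> s = -1"
      and step: "\<And>i. 0 \<le> i \<Longrightarrow> i + 1 < k \<Longrightarrow>
        [\<phi> (cyc_nth p (i + 1)) = \<phi> (cyc_nth p i) + s * cyc_nth w i] (mod n)" for s
  proof -
    define f where "f i = \<phi> (cyc_nth p i) - s * cyc_nth p i" for i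
    have f_step: "[f (i + 1) = f i] (mod n)" if "0 \<le> i" "i + 1 < k" for i
      using cong_diff[OF step[OF that] cong_scalar_left[OF p_step, of s i]]
      by (simp add: f_def algebra_simps)
    have "[\<phi> x - s * x = f 0] (mod n)" if "x \<in> P" for x
    proof -
      from that fin(1) obtain j where j: "j < length p" "x = p ! j"
        by (metis p_def in_set_conv_nth set_sorted_list_of_set)
      then have "x = cyc_nth p (int j)" by (simp add: cyc_nth_def)
      with cong_const_on_interval[of k f n "int j", OF f_step] j(1)
      show ?thesis by (simp add: f_def k_def)
    qed
    with s show thesis by (rule result)
  qed
  from iso obtain r where
    "(\<forall>i \<in> {0..<k}. \<phi> (cyc_nth p i) = cyc_nth q (r + i) \<and> cyc_nth w i = cyc_nth v (r + i)) \<or>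
     (\<forall>i \<in> {0..<k}. \<phi> (cyc_nth p i) = cyc_nth q (r - i) \<and> cyc_nth w i = cyc_nth v (r - i - 1))"
    unfolding wcycle_iso_def cycle_subgraph_def Let_def p_def q_def w_def v_def k_def
    by auto
  then show thesis
  proof
    assume *: "\<forall>i \<in> {0..<k}. \<phi> (cyc_nth p i) = cyc_nth q (r + i) \<and> cyc_nth w i = cyc_nth v (r + i)"
    show thesis
    proof (rule const[of 1])
      fix i :: int assume "0 \<le> i" "i + 1 < k"
      with * q_step[of "r + i"]
      show "[\<phi> (cyc_nth p (i + 1)) = \<phi> (cyc_nth p i) + 1 * cyc_nth w i] (mod n)"
        by (simp add: add.assoc)
    qed simp
  next
    assume *: "\<forall>i \<in> {0..<k}. \<phi> (cyc_nth p i) = cyc_nth q (r - i) \<and>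
      cyc_nth w i = cyc_nth v (r - i - 1)"
    show thesis
    proof (rule const[of "-1"])
      fix i :: int assume i: "0 \<le> i" "i + 1 < k"
      have "[cyc_nth q (r - i) = cyc_nth q (r - (i + 1)) + cyc_nth v (r - i - 1)] (mod n)"
        using q_step[of "r - i - 1"] by (simp add: algebra_simps)
      with * i have "[\<phi> (cyc_nth p i) = \<phi> (cyc_nth p (i + 1)) + cyc_nth w i] (mod n)"
        by simp
      from cong_diff[OF cong_sym[OF this] cong_refl[of "cyc_nth w i"]]
      show "[\<phi> (cyc_nth p (i + 1)) = \<phi> (cyc_nth p i) + -1 * cyc_nth w i] (mod n)"
        by simp
    qed simp
  qed
qed

theorem theorem1p5:
  fixes n :: int and P Q :: "int set" and \<phi> :: "int \<Rightarrow> int"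
  assumes "n > 0"
    and "pitch_class_set n P" and "P \<noteq> {}"
    and "pitch_class_set n Q" and "Q \<noteq> {}"
    and "card P = card Q"
    and "wcycle_iso (cycle_subgraph n P) (cycle_subgraph n Q) \<phi>"
  shows "wgraph_iso (pitch_class_graph n P) (pitch_class_graph n Q) \<phi>"
proof -
  have PQ: "P \<subseteq> {0..<n}" "Q \<subseteq> {0..<n}"
    using assms(2,4) by (simp_all add: pitch_class_set_def)
  then have fin: "finite P" "finite Q" by (auto intro: finite_subset)
  have bij: "bij_betw \<phi> P Q"
    using assms(7) fin by (simp add: wcycle_iso_def cycle_subgraph_def Let_def)
  obtain s c where s: "s = 1 \<or> s = -1" and
    c: "\<And>x. x \<in> P \<Longrightarrow> [\<phi> x - s * x = c] (mod n)"
    using cycle_iso_transposition_or_inversion[OF fin(1) assms(3) fin(2) assms(5,7)] by blast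
  have "ic n (\<phi> x) (\<phi> y) = ic n x y" if xy: "x \<in> P" "y \<in> P" for x y
  proof -
    have range: "x \<in> {0..<n}" "y \<in> {0..<n}" "\<phi> x \<in> {0..<n}" "\<phi> y \<in> {0..<n}"
      using xy PQ bij_betwE[OF bij] by blast+
    have "[\<phi> x - s * x = \<phi> y - s * y] (mod n)"
      using c[OF xy(1)] c[OF xy(2)] cong_sym cong_trans by blast
    then have diff: "[\<phi> x - \<phi> y = s * x - s * y] (mod n)"
      by (simp add: cong_iff_dvd_diff algebra_simps)
    from s show ?thesis
    proof
      assume "s = 1"
      with diff range show ?thesis by (intro ic_cong) auto
    next
      assume "s = -1"
      with diff range have "ic n (\<phi> x) (\<phi> y) = ic n y x" by (intro ic_cong) auto
      then show ?thesis by (simp add: ic_commute)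
    qed
  qed
  with bij show ?thesis by (simp add: wgraph_iso_def pitch_class_graph_def)
qed

end
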